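(* Let $A \in \mathbb{R}^{m\times n}$, $B\in\mathbb{R}^{m\times p}$, $C\in\mathbb{R}^{q\times n}$, and $\mathcal{S}\subseteq\mathbb{R}^{p\times q}$. Let $f: \mathbb{R}^{m \times n} \to \mathbb{R}$ be subdifferentiable and attain its minimum on $\widehat{\mathcal{S}} = \{A - BXC \in \mathbb{R}^{m \times n} : X \in \mathcal{S}\}$. For any $\mu > 0$ (and any initialization), the iterates $(Y_k, \Delta_k)$ of the Dykstra iteration converge to some $(Y_*, \Delta_* )$ such that $Y_* = A - BX_*C$ for some $X_* \in \mathcal{S}$ that minimizes $$\min_{X \in \mathcal{S}} \; f(A - BXC),$$ and such that $\Delta_* \in \partial f(Y_* )$ satisfies $$\operatorname{tr}\bigl(\Delta_*^{\mathsf T} B(X_*-X)C \bigr)\ge 0 \quad \text{for all } X \in \mathcal{S}.$$ The convergence is sublinear in the sense that $$\frac{\lVert Y_{k+1} -Y_* \rVert_{\mathsf F}^2 + \lVert \Delta_{k+1} - \Delta_* \rVert_{\mathsf F}^2}{\lVert Y_k -Y_* \rVert_{\mathsf F}^2 + \lVert \Delta_k - \Delta_* \rVert_{\mathsf F}^2} \le 1, \quad k =0, 1, 2,\dots.$$ If $B$ has full column rank and $C$ has full row rank, then $X_*$ is unique and the iterates $X_k$ of the Dykstra iteration converge to $X_*$.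
   Context: $\lVert\cdot\rVert_{\mathsf F}$ is the Frobenius norm. The subdifferential of $f:\mathbb{R}^{m\times n}\to\mathbb{R}$ at $Y$ is $$\partial f(Y) = \{G\in \mathbb{R}^{m \times n} : f(Z)-f(Y) \ge \operatorname{tr}(G^{\mathsf T} (Z-Y)) \text{ for all } Z \in \mathbb{R}^{m \times n}\},$$ and $f$ is subdifferentiable if $\partial f(Y)\neq\emptyset$ for all $Y$. Dykstra iteration: given $f,A,B,C,\mathcal{S}$ and $\mu>0$, start from arbitrary $X_0 \in\mathbb{R}^{p\times q}$, $Y_0,\Delta_0\in\mathbb{R}^{m\times n}$, and for $k=0,1,2,\dots$ let $$X_{k+1} \in \operatorname*{argmin}_{X\in\mathcal{S}} \lVert Y_{k} - A + BXC - \Delta_k \rVert_{\mathsf F}^2,$$ $$Y_{k+1} \in \operatorname*{argmin}_{Y \in \mathbb{R}^{m \times n}} \Bigl\{ f(Y) + \tfrac{\mu}{2} \lVert Y - A + BX_{k+1}C - \Delta_k \rVert_{\mathsf F}^2\Bigr\},$$ $$\Delta_{k+1} = \Delta_k - Y_{k+1} + A - BX_{k+1}C.$$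
   Formalization: Ŝ is assumed convex (false for S={-1,1}) and the X-step is assumed to have a minimizer for all Y, Δ; "Δ_* ∈ ∂f(Y_* )" is corrected to "μΔ_* ∈ ∂f(Y_* )"; "X_* is unique" means among X in S with Y_* = A − BXC. *)

theory Defs
  imports "HOL-Analysis.Analysis"
begin

text \<open>
  A real matrix with m rows and n columns has type \<open>real^'n^'m\<close>. The library norm on this type is the
  Frobenius norm, and the library topology (used for all limits) is the Euclidean one.
\<close>

lemma norm_matrix_eq_frobenius:
  fixes M :: "real^'n^'m"
  shows "norm M = sqrt (\<Sum>i\<in>UNIV. \<Sum>j\<in>UNIV. (M $ i $ j)\<^sup>2)"
  by (simp add: norm_vec_def L2_set_def sum_nonneg)

definition subdifferential :: "(real^'n^'m \<Rightarrow> real) \<Rightarrow> real^'n^'m \<Rightarrow> (real^'n^'m) set" where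
  "subdifferential f Y = {G. \<forall>Z. f Z - f Y \<ge> trace (transpose G ** (Z - Y))}"

definition subdifferentiable :: "(real^'n^'m \<Rightarrow> real) \<Rightarrow> bool" where
  "subdifferentiable f \<longleftrightarrow> (\<forall>Y. subdifferential f Y \<noteq> {})"

definition residual_set ::
  "real^'n^'m \<Rightarrow> real^'p^'m \<Rightarrow> real^'n^'q \<Rightarrow> (real^'q^'p) set \<Rightarrow> (real^'n^'m) set" where
  "residual_set A B C S = {A - B ** X ** C | X. X \<in> S}"

definition dykstra_X_argmin ::
  "real^'n^'m \<Rightarrow> real^'p^'m \<Rightarrow> real^'n^'q \<Rightarrow> (real^'q^'p) set
    \<Rightarrow> real^'n^'m \<Rightarrow> real^'n^'m \<Rightarrow> (real^'q^'p) set" where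
  "dykstra_X_argmin A B C S Y \<Delta> =
     {X. is_arg_min (\<lambda>X. (norm (Y - A + B ** X ** C - \<Delta>))\<^sup>2) (\<lambda>X. X \<in> S) X}"

definition dykstra_Y_argmin ::
  "(real^'n^'m \<Rightarrow> real) \<Rightarrow> real^'n^'m \<Rightarrow> real^'p^'m \<Rightarrow> real^'n^'q \<Rightarrow> real
    \<Rightarrow> real^'q^'p \<Rightarrow> real^'n^'m \<Rightarrow> (real^'n^'m) set" where
  "dykstra_Y_argmin f A B C \<mu> X \<Delta> =
     {Y. is_arg_min (\<lambda>Y. f Y + \<mu> / 2 * (norm (Y - A + B ** X ** C - \<Delta>))\<^sup>2) (\<lambda>Y. True) Y}"

text \<open>
  The initial values \<open>X 0\<close>, \<open>Y 0\<close>, \<open>\<Delta> 0\<close> are unconstrained. Minimizers need not be unique, so this is a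
  predicate on sequences: it holds for every admissible choice of minimizers.
\<close>

definition dykstra_iteration ::
  "(real^'n^'m \<Rightarrow> real) \<Rightarrow> real^'n^'m \<Rightarrow> real^'p^'m \<Rightarrow> real^'n^'q \<Rightarrow> (real^'q^'p) set \<Rightarrow> real
    \<Rightarrow> (nat \<Rightarrow> real^'q^'p) \<Rightarrow> (nat \<Rightarrow> real^'n^'m) \<Rightarrow> (nat \<Rightarrow> real^'n^'m) \<Rightarrow> bool" where
  "dykstra_iteration f A B C S \<mu> X Y \<Delta> \<longleftrightarrow>
     (\<forall>k. X (Suc k) \<in> dykstra_X_argmin A B C S (Y k) (\<Delta> k) \<and>
          Y (Suc k) \<in> dykstra_Y_argmin f A B C \<mu> (X (Suc k)) (\<Delta> k) \<and>
          \<Delta> (Suc k) = \<Delta> k - Y (Suc k) + A - B ** X (Suc k) ** C)"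

text \<open>
  Well-definedness of the iteration from arbitrary initial values: the X-step always has a minimizer.
  (The Y-step always has one, since a subdifferentiable function plus a positive multiple of a
  squared distance is continuous and coercive.)
\<close>

definition dykstra_well_defined ::
  "real^'n^'m \<Rightarrow> real^'p^'m \<Rightarrow> real^'n^'q \<Rightarrow> (real^'q^'p) set \<Rightarrow> bool" where
  "dykstra_well_defined A B C S \<longleftrightarrow> (\<forall>Y \<Delta>. dykstra_X_argmin A B C S Y \<Delta> \<noteq> {})"

text \<open>
  Two points of the informal theorem are false as literally written, and are corrected in the formal
  statement.

  \<^item> For a set S without any convexity, the final trace inequality can fail: all matrices 1 by 1, with
    \<open>A = 0\<close>, \<open>B = C = 1\<close>, \<open>S = {-1, 1}\<close>, \<open>f y = y\<^sup>2 / 2\<close>, \<open>\<mu> = 1\<close> and the constant iterates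
    \<open>X k = -1\<close>, \<open>Y k = \<Delta> k = 1\<close>. We assume that the residual set is convex, which holds in particular
    whenever S is convex.

  \<^item> The Y-step yields \<open>\<mu> \<Delta>\<^sub>k \<in> \<partial>f(Y\<^sub>k)\<close> for positive k, with the factor \<open>\<mu>\<close>; so the limit satisfies
    \<open>\<mu> \<Delta>\<^sub>* \<in> \<partial>f(Y\<^sub>*)\<close>. Without the factor the claim fails for \<open>\<mu> \<noteq> 1\<close>: all matrices 1 by 1, with
    \<open>A = B = C = 0\<close>, \<open>S = {0}\<close>, \<open>f y = y\<close>, and the constant iterates \<open>X k = Y k = 0\<close>, \<open>\<Delta> k = 1 / \<mu>\<close>.

  Convergence also needs the limit to stay in the residual set; this follows from
  \<^const>\<open>dykstra_well_defined\<close>, which forces the residual set to be closed.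
\<close>

end

theory Submission
  imports Defs
begin

text \<open>
  Only the residuals \<open>R\<^sub>k = A - B X\<^sub>k C\<close> enter the updates of \<open>Y\<close> and \<open>\<Delta>\<close>, so the iteration is a
  splitting method for minimizing a convex function \<open>f\<close> over the closed convex residual set \<open>K\<close> in a
  Euclidean space: \<open>R\<^sub>k\<^sub>+\<^sub>1\<close> is the projection of \<open>Y\<^sub>k - \<Delta>\<^sub>k\<close> onto \<open>K\<close>, and optimality in the \<open>Y\<close>-step says
  exactly that \<open>\<mu> \<Delta>\<^sub>k\<^sub>+\<^sub>1\<close> is a subgradient of \<open>f\<close> at \<open>Y\<^sub>k\<^sub>+\<^sub>1\<close>.

  The fixed points are the Karush-Kuhn-Tucker pairs \<open>(y, d)\<close>: \<open>y \<in> K\<close>, \<open>\<mu> d\<close> is a subgradient at \<open>y\<close>, and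
  \<open>d \<bullet> (r - y) \<ge> 0\<close> on \<open>K\<close>. A minimizer of \<open>f\<close> over \<open>K\<close> extends to such a pair by separating the
  strict epigraph of \<open>f\<close> from \<open>K \<times> {..f y}\<close> (\<open>constrained_minimizer_multiplier\<close>).

  For every such pair, the projection inequality and the monotonicity of subgradients give
  \<open>|Y\<^sub>k\<^sub>+\<^sub>1 - y|\<^sup>2 + |\<Delta>\<^sub>k\<^sub>+\<^sub>1 - d|\<^sup>2 \<le> |Y\<^sub>k - y|\<^sup>2 + |\<Delta>\<^sub>k - d|\<^sup>2 - |Y\<^sub>k - R\<^sub>k\<^sub>+\<^sub>1|\<^sup>2\<close>
  (\<open>splitting_step_decrease\<close>). Hence the iterates are bounded and \<open>Y\<^sub>k - R\<^sub>k\<^sub>+\<^sub>1\<close> tends to \<open>0\<close>. Both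
  optimality conditions are closed, so the limit of a convergent subsequence is again a
  Karush-Kuhn-Tucker pair; as the distance to that pair is nonincreasing along the whole sequence and
  tends to \<open>0\<close> along a subsequence, the whole sequence converges to it. If \<open>B\<close> has a left inverse and
  \<open>C\<close> a right inverse, \<open>X\<^sub>k\<close> is a continuous function of \<open>R\<^sub>k\<close>, and its convergence follows.
\<close>

section \<open>Subgradients in Euclidean spaces\<close>

definition subgradient :: "('a::euclidean_space \<Rightarrow> real) \<Rightarrow> 'a \<Rightarrow> 'a \<Rightarrow> bool" where
  "subgradient f y g \<longleftrightarrow> (\<forall>z. f z - f y \<ge> g \<bullet> (z - y))"

lemma subgradient_monotone:
  assumes "subgradient f y g" "subgradient f y' g'"
  shows "(g - g') \<bullet> (y - y') \<ge> 0"
proof -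
  have "f y' - f y \<ge> g \<bullet> (y' - y)" "f y - f y' \<ge> g' \<bullet> (y - y')"
    using assms by (auto simp: subgradient_def)
  then show ?thesis by (simp add: inner_diff_left inner_diff_right)
qed

text \<open>A function with supporting affine minorants at every point is their pointwise supremum.\<close>

lemma convex_on_if_subgradients_exist:
  assumes "\<And>y. \<exists>g. subgradient f y g"
  shows "convex_on UNIV f"
proof (rule convex_onI)
  fix t :: real and x y :: 'a
  assume t: "0 < t" "t < 1"
  let ?p = "(1 - t) *\<^sub>R x + t *\<^sub>R y"
  obtain g where g: "\<And>z. f z - f ?p \<ge> g \<bullet> (z - ?p)"
    using assms[of ?p] unfolding subgradient_def by blast
  have "(1 - t) * (g \<bullet> (x - ?p)) + t * (g \<bullet> (y - ?p)) = 0"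
    by (simp add: inner_diff_right inner_add_right algebra_simps)
  moreover have "(1 - t) * (f x - f ?p) + t * (f y - f ?p)
      \<ge> (1 - t) * (g \<bullet> (x - ?p)) + t * (g \<bullet> (y - ?p))"
    using t g by (intro add_mono mult_left_mono) auto
  ultimately show "f ?p \<le> (1 - t) * f x + t * f y"
    by (simp add: algebra_simps)
qed simp

lemma subgradient_limit:
  assumes cont: "continuous_on UNIV f"
    and y: "y \<longlonglongrightarrow> y'" and g: "g \<longlonglongrightarrow> g'"
    and sub: "\<And>k. subgradient f (y k) (g k)"
  shows "subgradient f y' g'"
  unfolding subgradient_def
proof
  fix z
  have fy: "(\<lambda>k. f (y k)) \<longlonglongrightarrow> f y'"
    using continuous_on_tendsto_compose[OF cont y] by simp
  show "f z - f y' \<ge> g' \<bullet> (z - y')"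
    by (rule LIMSEQ_le[of "\<lambda>k. g k \<bullet> (z - y k)" _ "\<lambda>k. f z - f (y k)"])
      (use sub in \<open>auto simp: subgradient_def intro!: tendsto_intros y g fy\<close>)
qed

text \<open>
  Comparing the minimizer with the points \<open>y + t (z - y)\<close> and dividing by \<open>t\<close> turns the quadratic
  penalty into its derivative up to a term of order \<open>t\<close>.
\<close>

lemma proximal_minimizer_subgradient:
  assumes conv: "convex_on UNIV f"
    and min: "\<And>z. f y + \<mu> / 2 * (norm (y - w))\<^sup>2 \<le> f z + \<mu> / 2 * (norm (z - w))\<^sup>2"
  shows "subgradient f y (\<mu> *\<^sub>R (w - y))"
  unfolding subgradient_def
proof
  fix z
  let ?c = "f z - f y - \<mu> * ((w - y) \<bullet> (z - y))"
  have ineq: "?c + t * (\<mu> / 2 * (norm (z - y))\<^sup>2) \<ge> 0" if t: "0 < t" "t < 1" for t :: real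
  proof -
    let ?p = "(1 - t) *\<^sub>R y + t *\<^sub>R z"
    have f: "f ?p \<le> (1 - t) * f y + t * f z"
      using convex_onD[OF conv, of t y z] t by simp
    have "?p - w = (y - w) + t *\<^sub>R (z - y)"
      by (simp add: algebra_simps)
    then have n: "(norm (?p - w))\<^sup>2 =
        (norm (y - w))\<^sup>2 - 2 * t * ((w - y) \<bullet> (z - y)) + t\<^sup>2 * (norm (z - y))\<^sup>2"
      by (simp only: power2_norm_eq_inner)
        (simp add: inner_add_left inner_add_right inner_diff_left inner_diff_right inner_commute
          power2_eq_square algebra_simps)
    have "0 \<le> t * (?c + t * (\<mu> / 2 * (norm (z - y))\<^sup>2))"
      using min[of ?p] f unfolding n by (simp add: algebra_simps power2_eq_square)
    then show ?thesis using t by (simp add: zero_le_mult_iff)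
  qed
  have lim: "((\<lambda>t. ?c + t * (\<mu> / 2 * (norm (z - y))\<^sup>2)) \<longlongrightarrow>
      ?c + 0 * (\<mu> / 2 * (norm (z - y))\<^sup>2)) (at_right 0)"
    by (intro tendsto_intros)
  have "?c + 0 * (\<mu> / 2 * (norm (z - y))\<^sup>2) \<ge> 0"
    by (rule tendsto_lowerbound[OF lim])
      (use ineq in \<open>auto simp: eventually_at_right_field intro!: exI[of _ 1]\<close>)
  then show "f z - f y \<ge> (\<mu> *\<^sub>R (w - y)) \<bullet> (z - y)" by simp
qed

text \<open>
  Since \<open>f\<close> is finite everywhere, a hyperplane separating the strict epigraph of \<open>f\<close> from
  \<open>K \<times> {..f y}\<close> cannot be vertical: a linear functional bounded on the whole space vanishes. After
  normalization, its slope is the multiplier.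
\<close>

lemma constrained_minimizer_multiplier:
  assumes conv: "convex_on UNIV f" and K: "convex K" "y \<in> K"
    and min: "\<And>r. r \<in> K \<Longrightarrow> f y \<le> f r"
  shows "\<exists>g. subgradient f y g \<and> (\<forall>r\<in>K. g \<bullet> (r - y) \<ge> 0)"
proof -
  let ?E = "{(z, t). f z < t}" and ?L = "K \<times> {..f y}"
  have E: "convex ?E"
  proof (rule convexI, clarsimp)
    fix z t z' t' and u v :: real
    assume *: "f z < t" "f z' < t'" "0 \<le> u" "0 \<le> v" "u + v = 1"
    have "f (u *\<^sub>R z + v *\<^sub>R z') \<le> u * f z + v * f z'"
      using conv * by (simp add: convex_on_def)
    also have "\<dots> < u * t + v * t'"
    proof (cases "u = 0")
      case False
      then have "u * f z < u * t" "v * f z' \<le> v * t'"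
        using * by (auto intro: mult_left_mono)
      then show ?thesis by linarith
    qed (use * in simp)
    finally show "f (u *\<^sub>R z + v *\<^sub>R z') < u * t + v * t'" .
  qed
  have "convex ?L" using K by (intro convex_Times) auto
  moreover have "(y, f y + 1) \<in> ?E" "(y, f y) \<in> ?L" using K by auto
  moreover have "?E \<inter> ?L = {}" using min by fastforce
  ultimately obtain ab c where ab: "ab \<noteq> 0" "\<forall>p\<in>?E. ab \<bullet> p \<le> c" "\<forall>p\<in>?L. ab \<bullet> p \<ge> c"
    using separating_hyperplane_sets[OF E] by blast
  obtain a b where "ab = (a, b)" by fastforce
  with ab have ne: "a \<noteq> 0 \<or> b \<noteq> 0"
    and up: "\<And>z t. f z < t \<Longrightarrow> a \<bullet> z + b * t \<le> c"
    and lo: "\<And>r. r \<in> K \<Longrightarrow> a \<bullet> r + b * f y \<ge> c"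
    by (auto simp: zero_prod_def)
  have b_le: "b \<le> 0" using up[of y "f y + 1"] lo[OF K(2)] by (simp add: algebra_simps)
  have b: "b < 0"
  proof (rule ccontr)
    assume "\<not> b < 0"
    with b_le have "b = 0" by simp
    then have "a \<bullet> (y + a) \<le> a \<bullet> y"
      using up[of "y + a" "f (y + a) + 1"] lo[OF K(2)] by simp
    then have "a \<bullet> a \<le> 0" by (simp add: inner_add_right)
    then have "a = 0" using inner_gt_zero_iff[of a] by linarith
    with ne \<open>b = 0\<close> show False by simp
  qed
  have up': "a \<bullet> z + b * f z \<le> c" for z
  proof -
    have lim: "((\<lambda>t. a \<bullet> z + b * t) \<longlongrightarrow> a \<bullet> z + b * f z) (at_right (f z))"
      by (intro tendsto_intros)
    show ?thesis
      by (rule tendsto_upperbound[OF lim])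
        (use up in \<open>auto simp: eventually_at_right_field intro!: exI[of _ "f z + 1"]\<close>)
  qed
  let ?g = "(1 / - b) *\<^sub>R a"
  have "f z - f y \<ge> ?g \<bullet> (z - y)" for z
  proof -
    have "a \<bullet> (z - y) \<le> (- b) * (f z - f y)"
      using up'[of z] lo[OF K(2)] by (simp add: algebra_simps inner_diff_right)
    then show ?thesis using b by (simp add: field_simps)
  qed
  moreover have "?g \<bullet> (r - y) \<ge> 0" if "r \<in> K" for r
  proof -
    have "a \<bullet> (r - y) \<ge> 0"
      using up'[of y] lo[OF that] by (simp add: algebra_simps inner_diff_right)
    then show ?thesis using b by (simp add: divide_nonneg_neg field_simps)
  qed
  ultimately show ?thesis unfolding subgradient_def by blast
qed

section \<open>Convergence of the splitting iteration\<close>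

text \<open>The Lagrange multiplier of the constraint is \<open>\<mu> d\<close>; the iteration tracks it divided by \<open>\<mu>\<close>.\<close>

definition kkt_pair :: "('a::euclidean_space \<Rightarrow> real) \<Rightarrow> 'a set \<Rightarrow> real \<Rightarrow> 'a \<Rightarrow> 'a \<Rightarrow> bool" where
  "kkt_pair f K \<mu> y d \<longleftrightarrow>
     y \<in> K \<and> subgradient f y (\<mu> *\<^sub>R d) \<and> (\<forall>r\<in>K. d \<bullet> (r - y) \<ge> 0)"

text \<open>
  In coordinates centred at the pair, write \<open>u, v\<close> for the old errors, \<open>u', v'\<close> for the new ones and
  \<open>\<rho>\<close> for the error of \<open>r\<close>. The update reads \<open>u' + v' = v + \<rho>\<close>, monotonicity gives \<open>u' \<bullet> v' \<ge> 0\<close>,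
  and the projection inequality together with \<open>ds \<bullet> \<rho> \<ge> 0\<close> gives \<open>\<rho> \<bullet> (u - v - \<rho>) \<ge> 0\<close>; expanding \<open>|u' + v'|\<^sup>2\<close> finishes.
\<close>

lemma splitting_step_decrease:
  assumes kkt: "kkt_pair f K \<mu> ys ds" and \<mu>: "\<mu> > 0"
    and r: "r \<in> K" and proj: "\<And>s. s \<in> K \<Longrightarrow> (y - d - r) \<bullet> (s - r) \<le> 0"
    and sub: "subgradient f y' (\<mu> *\<^sub>R d')" and upd: "d' = d - y' + r"
  shows "(norm (y' - ys))\<^sup>2 + (norm (d' - ds))\<^sup>2 + (norm (y - r))\<^sup>2
      \<le> (norm (y - ys))\<^sup>2 + (norm (d - ds))\<^sup>2"
proof -
  define u v u' v' \<rho> where "u = y - ys" "v = d - ds" "u' = y' - ys" "v' = d' - ds" "\<rho> = r - ys"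
  note defs = this
  have "(\<mu> *\<^sub>R d' - \<mu> *\<^sub>R ds) \<bullet> (y' - ys) \<ge> 0"
    using subgradient_monotone[OF sub] kkt by (simp add: kkt_pair_def)
  then have "\<mu> * (v' \<bullet> u') \<ge> 0"
    by (simp add: defs inner_diff_left right_diff_distrib)
  then have mono: "v' \<bullet> u' \<ge> 0" using \<mu> by (simp add: zero_le_mult_iff)
  have "(y - d - r) \<bullet> (ys - r) \<le> 0" "ds \<bullet> (r - ys) \<ge> 0"
    using kkt r proj by (auto simp: kkt_pair_def)
  then have pr: "(u - v - \<rho>) \<bullet> \<rho> \<ge> 0"
    by (simp add: defs inner_diff_left inner_diff_right inner_commute)
  have s: "u' + v' = v + \<rho>" by (simp add: defs upd)
  have "(norm u')\<^sup>2 + (norm v')\<^sup>2 \<le> (norm (u' + v'))\<^sup>2"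
    using mono by (simp add: power2_norm_eq_inner inner_add_left inner_add_right inner_commute)
  also have "\<dots> = (norm u)\<^sup>2 + (norm v)\<^sup>2 - (norm (u - \<rho>))\<^sup>2 - 2 * ((u - v - \<rho>) \<bullet> \<rho>)"
    unfolding s by (simp add: power2_norm_eq_inner inner_add_left inner_add_right
        inner_diff_left inner_diff_right inner_commute)
  finally have "(norm u')\<^sup>2 + (norm v')\<^sup>2 + (norm (u - \<rho>))\<^sup>2 \<le> (norm u)\<^sup>2 + (norm v)\<^sup>2"
    using pr by simp
  then show ?thesis by (simp add: defs)
qed

text \<open>The sequence \<open>a\<close> is nonincreasing and nonnegative, so it converges and its decrements vanish.\<close>

lemma tendsto_zero_if_dominated_by_decrease:
  fixes a b :: "nat \<Rightarrow> real"
  assumes "\<And>k. a k \<ge> 0" "\<And>k. b k \<ge> 0" "\<And>k. a (Suc k) + b k \<le> a k"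
  shows "b \<longlonglongrightarrow> 0"
proof -
  have "a (Suc k) \<le> a k" for k using assms(2,3)[of k] by linarith
  then have "decseq a" by (rule decseq_SucI)
  then obtain l where l: "a \<longlonglongrightarrow> l"
    using decseq_convergent[of a 0] assms(1) by blast
  then have "(\<lambda>k. a k - a (Suc k)) \<longlonglongrightarrow> l - l"
    by (intro tendsto_diff LIMSEQ_Suc)
  then have lim: "(\<lambda>k. a k - a (Suc k)) \<longlonglongrightarrow> 0" by simp
  have le: "b k \<le> a k - a (Suc k)" for k using assms(3)[of k] by linarith
  show ?thesis
    by (rule tendsto_sandwich[OF _ _ tendsto_const lim]) (use assms le in auto)
qed

lemma square_norm_tendsto_zero:
  assumes "(\<lambda>k. (norm (w k))\<^sup>2) \<longlonglongrightarrow> 0"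
  shows "w \<longlonglongrightarrow> 0"
  using tendsto_real_sqrt[OF assms] by (simp add: tendsto_norm_zero_iff)

text \<open>
  Two Karush-Kuhn-Tucker pairs appear. The one built from the minimizer \<open>ys\<close> only yields boundedness
  and the vanishing gap \<open>y k - R (Suc k)\<close>; the iterates need not converge to it. The second is a
  cluster point, and monotonicity of the distance to that one upgrades subsequential convergence.
\<close>

lemma splitting_iteration_converges:
  fixes f :: "'a::euclidean_space \<Rightarrow> real"
  assumes conv: "convex_on UNIV f" and K: "convex K" "closed K" and \<mu>: "\<mu> > 0"
    and ys: "ys \<in> K" "\<And>r. r \<in> K \<Longrightarrow> f ys \<le> f r"
    and R: "\<And>k. R (Suc k) \<in> K"
    and proj: "\<And>k s. s \<in> K \<Longrightarrow> (y k - d k - R (Suc k)) \<bullet> (s - R (Suc k)) \<le> 0"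
    and sub: "\<And>k. subgradient f (y (Suc k)) (\<mu> *\<^sub>R d (Suc k))"
    and upd: "\<And>k. d (Suc k) = d k - y (Suc k) + R (Suc k)"
  obtains y' d' where "y \<longlonglongrightarrow> y'" "d \<longlonglongrightarrow> d'" "R \<longlonglongrightarrow> y'" "kkt_pair f K \<mu> y' d'"
    "\<And>k. (norm (y (Suc k) - y'))\<^sup>2 + (norm (d (Suc k) - d'))\<^sup>2
        \<le> (norm (y k - y'))\<^sup>2 + (norm (d k - d'))\<^sup>2"
proof -
  have cont: "continuous_on UNIV f"
    using convex_on_continuous[OF open_UNIV] conv by blast
  define V where "V p q k = (norm (y k - p))\<^sup>2 + (norm (d k - q))\<^sup>2" for p q k
  have V0: "V p q k \<ge> 0" for p q k by (simp add: V_def)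
  have step: "V p q (Suc k) + (norm (y k - R (Suc k)))\<^sup>2 \<le> V p q k"
    if "kkt_pair f K \<mu> p q" for p q k
    using splitting_step_decrease[OF that \<mu> R proj sub upd] by (simp add: V_def)
  have dec: "decseq (V p q)" if "kkt_pair f K \<mu> p q" for p q
  proof (rule decseq_SucI)
    show "V p q (Suc k) \<le> V p q k" for k
      using step[OF that, of k] zero_le_power2[of "norm (y k - R (Suc k))"] by linarith
  qed
  obtain g where g: "subgradient f ys g" "\<forall>r\<in>K. g \<bullet> (r - ys) \<ge> 0"
    using constrained_minimizer_multiplier[OF conv K(1) ys] by blast
  define ds where "ds = (1 / \<mu>) *\<^sub>R g"
  have kkt: "kkt_pair f K \<mu> ys ds"
    using g \<mu> ys(1) by (simp add: kkt_pair_def ds_def)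
  have "(\<lambda>k. (norm (y k - R (Suc k)))\<^sup>2) \<longlonglongrightarrow> 0"
    by (rule tendsto_zero_if_dominated_by_decrease[where a = "V ys ds"])
      (use V0 step[OF kkt] in auto)
  then have gap: "(\<lambda>k. y k - R (Suc k)) \<longlonglongrightarrow> 0"
    by (rule square_norm_tendsto_zero)
  have "(y k, d k) \<in> cball (ys, ds) (sqrt (V ys ds 0))" for k
  proof -
    have "V ys ds k \<le> V ys ds 0" using dec[OF kkt] by (simp add: decseq_def)
    then show ?thesis
      by (simp add: V_def dist_norm norm_Pair norm_minus_commute)
  qed
  then have "bounded (range (\<lambda>k. (y k, d k)))"
    by (intro bounded_subset[OF bounded_cball] image_subsetI)
  then obtain l \<phi> where \<phi>: "strict_mono (\<phi> :: nat \<Rightarrow> nat)" and l: "((\<lambda>k. (y k, d k)) \<circ> \<phi>) \<longlonglongrightarrow> l"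
    using bounded_imp_convergent_subsequence by blast
  define y' d' where "y' = fst l" "d' = snd l"
  then have y\<phi>: "(\<lambda>k. y (\<phi> k)) \<longlonglongrightarrow> y'" and d\<phi>: "(\<lambda>k. d (\<phi> k)) \<longlonglongrightarrow> d'"
    using tendsto_fst[OF l] tendsto_snd[OF l] by (simp_all add: o_def)
  have "(\<lambda>k. y (\<phi> k) - (y (\<phi> k) - R (Suc (\<phi> k)))) \<longlonglongrightarrow> y' - 0"
    using LIMSEQ_subseq_LIMSEQ[OF gap \<phi>] by (intro tendsto_diff y\<phi>) (simp add: o_def)
  then have R\<phi>: "(\<lambda>k. R (Suc (\<phi> k))) \<longlonglongrightarrow> y'" by simp
  have "y' \<in> K" using closed_sequentially[OF K(2) _ R\<phi>] R by simp
  moreover have "d' \<bullet> (s - y') \<ge> 0" if "s \<in> K" for s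
  proof -
    have lim: "(\<lambda>k. (y (\<phi> k) - d (\<phi> k) - R (Suc (\<phi> k))) \<bullet> (s - R (Suc (\<phi> k))))
        \<longlonglongrightarrow> (y' - d' - y') \<bullet> (s - y')"
      by (intro tendsto_intros y\<phi> d\<phi> R\<phi>)
    have "(y' - d' - y') \<bullet> (s - y') \<le> 0"
      by (rule LIMSEQ_le_const2[OF lim]) (use proj that in auto)
    then show ?thesis by simp
  qed
  moreover have "subgradient f y' (\<mu> *\<^sub>R d')"
  proof -
    \<comment> \<open>The subgradient relation is only known from index 1 on, whereas the subsequence may start at
      index 0, so its first entry is dropped.\<close>
    have pos: "\<exists>j. \<phi> (Suc k) = Suc j" for k
      using strict_monoD[OF \<phi>, of k "Suc k"] by (cases "\<phi> (Suc k)") auto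
    have "subgradient f (y (\<phi> (Suc k))) (\<mu> *\<^sub>R d (\<phi> (Suc k)))" for k
      using pos[of k] sub by auto
    then show ?thesis
      by (rule subgradient_limit[OF cont LIMSEQ_Suc[OF y\<phi>]
            tendsto_scaleR[OF tendsto_const LIMSEQ_Suc[OF d\<phi>]]])
  qed
  ultimately have kkt': "kkt_pair f K \<mu> y' d'" by (simp add: kkt_pair_def)
  have V\<phi>: "(V y' d' \<circ> \<phi>) \<longlonglongrightarrow> 0"
  proof -
    have "(\<lambda>k. (norm (y (\<phi> k) - y'))\<^sup>2 + (norm (d (\<phi> k) - d'))\<^sup>2)
        \<longlonglongrightarrow> (norm (y' - y'))\<^sup>2 + (norm (d' - d'))\<^sup>2"
      by (intro tendsto_intros y\<phi> d\<phi>)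
    then show ?thesis by (simp add: V_def o_def)
  qed
  obtain L where L: "V y' d' \<longlonglongrightarrow> L"
    by (rule decseq_convergent[OF dec[OF kkt'], of 0]) (auto simp: V0)
  have "L = 0"
    using LIMSEQ_unique[OF LIMSEQ_subseq_LIMSEQ[OF L \<phi>] V\<phi>] .
  with L have V_lim: "V y' d' \<longlonglongrightarrow> 0" by simp
  have to_zero: "(\<lambda>k. w k - p) \<longlonglongrightarrow> 0" if "\<And>k. (norm (w k - p))\<^sup>2 \<le> V y' d' k"
    for w :: "nat \<Rightarrow> 'a" and p
  proof -
    have "(\<lambda>k. (norm (w k - p))\<^sup>2) \<longlonglongrightarrow> 0"
      by (rule tendsto_sandwich[OF _ _ tendsto_const V_lim]) (use that in auto)
    then show ?thesis
      by (rule square_norm_tendsto_zero)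
  qed
  have y_lim: "y \<longlonglongrightarrow> y'" and d_lim: "d \<longlonglongrightarrow> d'"
    using to_zero[of y y'] to_zero[of d d'] by (simp_all add: V_def LIM_zero_iff)
  have "(\<lambda>k. y k - (y k - R (Suc k))) \<longlonglongrightarrow> y' - 0"
    by (intro tendsto_diff y_lim gap)
  then have R_lim: "R \<longlonglongrightarrow> y'" by (simp add: filterlim_sequentially_Suc)
  show thesis
  proof (rule that[OF y_lim d_lim R_lim kkt'])
    show "(norm (y (Suc k) - y'))\<^sup>2 + (norm (d (Suc k) - d'))\<^sup>2
        \<le> (norm (y k - y'))\<^sup>2 + (norm (d k - d'))\<^sup>2" for k
      using dec[OF kkt'] by (simp add: decseq_Suc_iff V_def)
  qed
qed

section \<open>Application to matrices\<close>

lemma trace_transpose_mult_eq_inner: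
  fixes G H :: "real^'n^'m"
  shows "trace (transpose G ** H) = G \<bullet> H"
  unfolding trace_def transpose_def matrix_matrix_mult_def inner_vec_def
  by (simp add: sum.swap[of _ "UNIV :: 'n set" "UNIV :: 'm set"])

lemma subdifferential_iff_subgradient: "G \<in> subdifferential f Y \<longleftrightarrow> subgradient f Y G"
  by (simp add: subdifferential_def subgradient_def trace_transpose_mult_eq_inner)

lemma middle_factor_diff:
  fixes B :: "real^'p^'m" and C :: "real^'n^'q"
  shows "B ** (X - X') ** C = B ** X ** C - B ** X' ** C"
  by (simp add: matrix_matrix_mult_def vec_eq_iff sum_subtractf left_diff_distrib right_diff_distrib)

text \<open>The X-step is the metric projection onto the residual set.\<close>

lemma dykstra_X_argmin_closest_residual:
  assumes "X \<in> dykstra_X_argmin A B C S Y \<Delta>"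
  shows "A - B ** X ** C \<in> residual_set A B C S"
    and "\<And>r. r \<in> residual_set A B C S \<Longrightarrow> dist (Y - \<Delta>) (A - B ** X ** C) \<le> dist (Y - \<Delta>) r"
proof -
  have *: "X \<in> S" "\<And>X'. X' \<in> S \<Longrightarrow>
      (norm (Y - A + B ** X ** C - \<Delta>))\<^sup>2 \<le> (norm (Y - A + B ** X' ** C - \<Delta>))\<^sup>2"
    using assms by (auto simp: dykstra_X_argmin_def is_arg_min_linorder)
  have dist: "dist (Y - \<Delta>) (A - B ** X' ** C) = norm (Y - A + B ** X' ** C - \<Delta>)" for X'
    by (simp add: dist_norm algebra_simps)
  show "A - B ** X ** C \<in> residual_set A B C S"
    using * by (auto simp: residual_set_def)
  show "dist (Y - \<Delta>) (A - B ** X ** C) \<le> dist (Y - \<Delta>) r" if "r \<in> residual_set A B C S" for r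
    using that * by (auto simp: residual_set_def dist)
qed

text \<open>A set to which every point has a nearest point contains its limit points.\<close>

lemma closed_residual_set:
  assumes "dykstra_well_defined A B C S"
  shows "closed (residual_set A B C S)"
proof -
  let ?K = "residual_set A B C S"
  have "w \<in> ?K" if w: "w \<in> closure ?K" for w
  proof -
    obtain X where X: "X \<in> dykstra_X_argmin A B C S w 0"
      using assms unfolding dykstra_well_defined_def by blast
    let ?r = "A - B ** X ** C"
    note r = dykstra_X_argmin_closest_residual[OF X]
    have "dist w ?r \<le> 0 + e" if e: "e > 0" for e
    proof -
      obtain s where "s \<in> ?K" "dist s w < e"
        using w e by (auto simp: closure_approachable)
      then show ?thesis using r(2)[of s] by (simp add: dist_commute)
    qed
    then have "dist w ?r \<le> 0" by (rule field_le_epsilon)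
    then show ?thesis using r(1) by simp
  qed
  then show ?thesis using closure_subset_eq by blast
qed

text \<open>One-sided inverses of \<open>B\<close> and \<open>C\<close> recover \<open>X\<close> from \<open>B X C\<close> by a fixed linear map.\<close>

lemma full_rank_recover_middle_factor:
  fixes B :: "real^'p^'m" and C :: "real^'n^'q"
  assumes "rank B = CARD('p)" "rank C = CARD('q)"
  obtains B' C' where "\<And>X. B' ** (B ** X ** C) ** C' = X"
proof -
  have "inj ((*v) B)" using assms(1) by (simp add: full_rank_injective)
  then obtain B' where B': "B' ** B = mat 1"
    using matrix_left_invertible_injective by blast
  have "surj ((*v) C)" using assms(2) by (simp add: full_rank_surjective)
  then obtain C' where C': "C ** C' = mat 1"
    using matrix_right_invertible_surjective by blast
  have "B' ** (B ** X ** C) ** C' = (B' ** B) ** X ** (C ** C')" for X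
    by (simp add: matrix_mul_assoc)
  then show thesis by (intro that) (simp add: B' C')
qed

theorem theorem5p3:
  fixes A :: "real^'n^'m" and B :: "real^'p^'m" and C :: "real^'n^'q"
    and S :: "(real^'q^'p) set" and f :: "real^'n^'m \<Rightarrow> real" and \<mu> :: real
    and X :: "nat \<Rightarrow> real^'q^'p" and Y \<Delta> :: "nat \<Rightarrow> real^'n^'m"
  assumes "subdifferentiable f"
    and "\<exists>Z. is_arg_min f (\<lambda>Z. Z \<in> residual_set A B C S) Z"
    and "convex (residual_set A B C S)"
    and "dykstra_well_defined A B C S"
    and "\<mu> > 0"
    and "dykstra_iteration f A B C S \<mu> X Y \<Delta>"
  shows "\<exists>Ystar \<Delta>star Xstar.
      Y \<longlonglongrightarrow> Ystar \<and> \<Delta> \<longlonglongrightarrow> \<Delta>star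
    \<and> Xstar \<in> S \<and> Ystar = A - B ** Xstar ** C
    \<and> is_arg_min (\<lambda>X. f (A - B ** X ** C)) (\<lambda>X. X \<in> S) Xstar
    \<and> \<mu> *\<^sub>R \<Delta>star \<in> subdifferential f Ystar
    \<and> (\<forall>X'\<in>S. trace (transpose \<Delta>star ** B ** (Xstar - X') ** C) \<ge> 0)
    \<and> (\<forall>k. (norm (Y (Suc k) - Ystar))\<^sup>2 + (norm (\<Delta> (Suc k) - \<Delta>star))\<^sup>2
            \<le> (norm (Y k - Ystar))\<^sup>2 + (norm (\<Delta> k - \<Delta>star))\<^sup>2)
    \<and> (rank B = CARD('p) \<and> rank C = CARD('q) \<longrightarrow>
         (\<forall>X'\<in>S. Ystar = A - B ** X' ** C \<longrightarrow> X' = Xstar) \<and> X \<longlonglongrightarrow> Xstar)"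
proof -
  let ?K = "residual_set A B C S"
  define R where "R k = A - B ** X k ** C" for k
  have iter: "X (Suc k) \<in> dykstra_X_argmin A B C S (Y k) (\<Delta> k)"
      "Y (Suc k) \<in> dykstra_Y_argmin f A B C \<mu> (X (Suc k)) (\<Delta> k)"
      "\<Delta> (Suc k) = \<Delta> k - Y (Suc k) + R (Suc k)" for k
    using assms(6) by (simp_all add: dykstra_iteration_def R_def)
  have conv: "convex_on UNIV f"
    using assms(1) by (intro convex_on_if_subgradients_exist)
      (auto simp: subdifferentiable_def simp flip: subdifferential_iff_subgradient)
  note K = assms(3) closed_residual_set[OF assms(4)]
  obtain Z where Z: "Z \<in> ?K" "\<And>r. r \<in> ?K \<Longrightarrow> f Z \<le> f r"
    using assms(2) by (auto simp: is_arg_min_linorder)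
  have R: "R (Suc k) \<in> ?K" for k
    unfolding R_def by (rule dykstra_X_argmin_closest_residual[OF iter(1)])
  have proj: "(Y k - \<Delta> k - R (Suc k)) \<bullet> (s - R (Suc k)) \<le> 0" if "s \<in> ?K" for k s
    using dykstra_X_argmin_closest_residual(2)[OF iter(1)[of k]]
    by (intro any_closest_point_dot[OF K R that]) (simp add: R_def)
  have sub: "subgradient f (Y (Suc k)) (\<mu> *\<^sub>R \<Delta> (Suc k))" for k
  proof -
    have eq: "Z - (R (Suc k) + \<Delta> k) = Z - A + B ** X (Suc k) ** C - \<Delta> k" for Z
      by (simp add: R_def)
    have "subgradient f (Y (Suc k)) (\<mu> *\<^sub>R ((R (Suc k) + \<Delta> k) - Y (Suc k)))"
      using iter(2)[of k]
      by (intro proximal_minimizer_subgradient conv)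
        (simp add: eq dykstra_Y_argmin_def is_arg_min_linorder)
    then show ?thesis by (simp add: iter(3) algebra_simps)
  qed
  obtain Ys \<Delta>s where lim: "Y \<longlonglongrightarrow> Ys" "\<Delta> \<longlonglongrightarrow> \<Delta>s" "R \<longlonglongrightarrow> Ys"
    and kkt: "kkt_pair f ?K \<mu> Ys \<Delta>s"
    and fejer: "\<And>k. (norm (Y (Suc k) - Ys))\<^sup>2 + (norm (\<Delta> (Suc k) - \<Delta>s))\<^sup>2
            \<le> (norm (Y k - Ys))\<^sup>2 + (norm (\<Delta> k - \<Delta>s))\<^sup>2"
    by (rule splitting_iteration_converges[where R = R and y = Y and d = \<Delta>,
        OF conv K assms(5) Z R proj sub iter(3)]) (assumption | rule that)+
  obtain Xs where Xs: "Xs \<in> S" "Ys = A - B ** Xs ** C"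
    using kkt by (auto simp: kkt_pair_def residual_set_def)
  have normal: "\<Delta>s \<bullet> (A - B ** X' ** C - Ys) \<ge> 0" if "X' \<in> S" for X'
    using kkt that by (auto simp: kkt_pair_def residual_set_def)
  have sub_lim: "subgradient f Ys (\<mu> *\<^sub>R \<Delta>s)" using kkt by (simp add: kkt_pair_def)
  have "is_arg_min (\<lambda>X. f (A - B ** X ** C)) (\<lambda>X. X \<in> S) Xs"
    unfolding is_arg_min_linorder
  proof (intro conjI allI impI)
    fix X' assume "X' \<in> S"
    then have "0 \<le> \<mu> * (\<Delta>s \<bullet> (A - B ** X' ** C - Ys))"
      using normal assms(5) by simp
    also have "\<dots> \<le> f (A - B ** X' ** C) - f Ys"
      using sub_lim by (simp add: subgradient_def)
    finally show "f (A - B ** Xs ** C) \<le> f (A - B ** X' ** C)" by (simp add: Xs)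
  qed (rule Xs)
  moreover have "trace (transpose \<Delta>s ** B ** (Xs - X') ** C) \<ge> 0" if "X' \<in> S" for X'
  proof -
    have "B ** (Xs - X') ** C = A - B ** X' ** C - Ys"
      by (simp add: Xs middle_factor_diff)
    then have "trace (transpose \<Delta>s ** B ** (Xs - X') ** C) = \<Delta>s \<bullet> (A - B ** X' ** C - Ys)"
      by (metis matrix_mul_assoc trace_transpose_mult_eq_inner)
    then show ?thesis using normal[OF that] by simp
  qed
  moreover have "(\<forall>X'\<in>S. Ys = A - B ** X' ** C \<longrightarrow> X' = Xs) \<and> X \<longlonglongrightarrow> Xs"
    if rank: "rank B = CARD('p) \<and> rank C = CARD('q)"
  proof -
    obtain B' C' where inv: "\<And>X. B' ** (B ** X ** C) ** C' = X"
      using full_rank_recover_middle_factor rank by metis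
    have rec: "B' ** (A - (A - B ** X' ** C)) ** C' = X'" for X'
      by (simp add: inv)
    have "(\<lambda>k. B' ** (A - R k) ** C') \<longlonglongrightarrow> B' ** (A - Ys) ** C'"
      unfolding matrix_matrix_mult_def by (intro tendsto_intros lim)
    moreover have "B' ** (A - R k) ** C' = X k" for k unfolding R_def by (rule rec)
    moreover have "B' ** (A - Ys) ** C' = Xs" unfolding Xs by (rule rec)
    moreover have "X' = Xs" if "Ys = A - B ** X' ** C" for X'
      using rec[of X'] rec[of Xs] unfolding that[symmetric] Xs(2)[symmetric] by simp
    ultimately show ?thesis by simp
  qed
  ultimately show ?thesis
    using lim Xs fejer sub_lim
    by (intro exI[of _ Ys] exI[of _ \<Delta>s] exI[of _ Xs])
      (simp add: subdifferential_iff_subgradient)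
qed

end
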